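(* Let $n\geq 3$ and $\sigma\geq 2$ be integers. Let $D_w=(0,0,\dots,0,\sigma)$ be the $n$-die with $n-1$ faces equal to $0$ and one face equal to $\sigma$. Then for every $n$-die $D=(f_1,\dots,f_n)$ with $\sum_{i=1}^n f_i=\sigma$ and $D\neq D_w$, one has $D\succ D_w$.
   Context: An $n$-die is a non-decreasing sequence $D=(f_1,f_2,\dots,f_n)$ of non-negative integers (repetitions allowed); the $f_i$ are its faces. For two $n$-dice $D=(f_1,\dots,f_n)$ and $D'=(f'_1,\dots,f'_n)$ put $\gamma(D,D')=\sum_{i=1}^n \mathrm{Card}\{j\in\{1,\dots,n\} \mid f_i>f'_j\}$ and $\Delta(D,D')=\gamma(D,D')-\gamma(D',D)$. One writes $D\succ D'$ if $\Delta(D,D')>0$. *)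

theory Defs
  imports Main
begin

text \<open>A die is the list of its faces; face \<open>f\<^sub>i\<close> of the mathematics is \<open>D ! (i - 1)\<close>.\<close>

definition is_die :: "nat \<Rightarrow> nat list \<Rightarrow> bool" where
  "is_die n D \<longleftrightarrow> length D = n \<and> sorted D"

text \<open>The comparison functions are only meant for two dice with the same number of faces.\<close>

definition die_gamma :: "nat list \<Rightarrow> nat list \<Rightarrow> nat" where
  "die_gamma D D' = (\<Sum>i<length D. card {j. j < length D' \<and> D ! i > D' ! j})"

definition die_Delta :: "nat list \<Rightarrow> nat list \<Rightarrow> int" where
  "die_Delta D D' = int (die_gamma D D') - int (die_gamma D' D)"

definition beats :: "nat list \<Rightarrow> nat list \<Rightarrow> bool"  (infix "\<succ>" 50) where
  "D \<succ> D' \<longleftrightarrow> die_Delta D D' > 0"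

definition D_w :: "nat \<Rightarrow> nat \<Rightarrow> nat list" where
  "D_w n \<sigma> = replicate (n - 1) 0 @ [\<sigma>]"

end

theory Submission
  imports Defs
begin

text \<open>The zeros of \<open>D_w n \<sigma>\<close> beat nothing and its last face beats at most \<open>n\<close> faces, so
  \<open>D_w n \<sigma>\<close> scores at most \<open>n\<close>. A die of total \<open>\<sigma>\<close> other than \<open>D_w n \<sigma>\<close> has at least two
  positive faces, each beating \<open>n - 1\<close> zeros, so it scores at least \<open>2 (n - 1) > n\<close>.\<close>

lemma length_D_w: "n > 0 \<Longrightarrow> length (D_w n \<sigma>) = n"
  by (simp add: D_w_def)

lemma D_w_nth_eq_0: "j < n - 1 \<Longrightarrow> D_w n \<sigma> ! j = 0"
  by (simp add: D_w_def nth_append)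

lemma die_gamma_D_w_le:
  assumes "n > 0"
  shows "die_gamma (D_w n \<sigma>) D \<le> length D"
proof -
  let ?c = "\<lambda>i. card {j. j < length D \<and> D_w n \<sigma> ! i > D ! j}"
  \<comment> \<open>Writing \<open>n\<close> as \<open>Suc (n - 1)\<close> splits off the term of
    the last face; in every other term no face is below 0.\<close>
  have "die_gamma (D_w n \<sigma>) D = (\<Sum>i<Suc (n - 1). ?c i)"
    using assms by (simp add: die_gamma_def length_D_w)
  also have "\<dots> = ?c (n - 1)"
    by (simp add: D_w_nth_eq_0)
  also have "\<dots> \<le> card {..<length D}"
    by (rule card_mono) auto
  finally show ?thesis by simp
qed

lemma card_beaten_D_w_ge:
  assumes "x > 0"
  shows "n - 1 \<le> card {j. j < length (D_w n \<sigma>) \<and> x > D_w n \<sigma> ! j}"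
proof -
  have "card {..<n - 1} \<le> card {j. j < length (D_w n \<sigma>) \<and> x > D_w n \<sigma> ! j}"
    \<comment> \<open>\<open>length_D_w\<close> would require \<open>n > 0\<close>, so the length is
      read off \<open>D_w_def\<close> instead.\<close>
    using assms by (intro card_mono) (auto simp: D_w_nth_eq_0, simp add: D_w_def)
  then show ?thesis by simp
qed

lemma die_gamma_D_w_ge:
  assumes "i < j" "j < length D" "D ! i > 0" "D ! j > 0"
  shows "2 * (n - 1) \<le> die_gamma D (D_w n \<sigma>)"
proof -
  let ?c = "\<lambda>i. card {j. j < length (D_w n \<sigma>) \<and> D ! i > D_w n \<sigma> ! j}"
  have "2 * (n - 1) \<le> ?c i + ?c j"
    using card_beaten_D_w_ge[OF assms(3), of n \<sigma>] card_beaten_D_w_ge[OF assms(4), of n \<sigma>]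
    by linarith
  \<comment> \<open>Since \<open>i < j\<close>, the indices differ and both terms count, even if the
    faces are equal.\<close>
  also have "\<dots> = sum ?c {i, j}"
    using assms(1) by simp
  also have "\<dots> \<le> sum ?c {..<length D}"
    using assms(1,2) by (intro sum_mono2) auto
  finally show ?thesis by (simp add: die_gamma_def)
qed

text \<open>If all faces before the last were 0, the last would equal the total and \<open>D\<close>
  would be the excluded die. So an earlier face is positive, and sortedness makes the last one
  positive too.\<close>

lemma two_positive_faces:
  assumes die: "is_die n D" and "n > 0" and ne: "D \<noteq> D_w n (sum_list D)"
  obtains i j where "i < j" "j < n" "D ! i > 0" "D ! j > 0"
proof -
  have len: "length D = n" and srt: "sorted D"
    using die by (auto simp: is_die_def)
  have D: "D = butlast D @ [last D]"
    using len \<open>n > 0\<close> by (cases D) auto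
  have "\<exists>i < n - 1. D ! i > 0"
  proof (rule ccontr)
    assume "\<not> ?thesis"
    then have b: "butlast D = replicate (n - 1) 0"
      using len by (intro nth_equalityI) (auto simp: nth_butlast)
    then have "D = replicate (n - 1) 0 @ [last D]"
      using D by simp
    moreover from this have "sum_list D = last D"
      by (metis add_0 sum_list.Cons sum_list.Nil sum_list_append sum_list_replicate
          mult_0_right add_0_right)
    ultimately show False
      using ne by (simp add: D_w_def)
  qed
  then obtain i where i: "i < n - 1" "D ! i > 0" by blast
  moreover have "D ! i \<le> D ! (n - 1)"
    using srt len i(1) by (intro sorted_nth_mono) auto
  ultimately show thesis
    by (intro that[of i "n - 1"]) auto
qed

theorem proposition3p5:
  fixes n \<sigma> :: nat and D :: "nat list"
  assumes "n \<ge> 3" and "\<sigma> \<ge> 2"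
    and "is_die n D" and "sum_list D = \<sigma>" and "D \<noteq> D_w n \<sigma>"
  shows "D \<succ> D_w n \<sigma>"
proof -
  have len: "length D = n"
    using assms(3) by (simp add: is_die_def)
  obtain i j where "i < j" "j < n" "D ! i > 0" "D ! j > 0"
    using two_positive_faces[OF assms(3)] assms by auto
  then have "2 * (n - 1) \<le> die_gamma D (D_w n \<sigma>)"
    using len by (intro die_gamma_D_w_ge[of i j]) auto
  moreover have "die_gamma (D_w n \<sigma>) D \<le> n"
    using die_gamma_D_w_le[of n \<sigma> D] assms(1) len by simp
  \<comment> \<open>Here \<open>n \<ge> 3\<close> enters: \<open>2 * (n - 1) > n\<close> amounts to
    \<open>n > 2\<close>.\<close>
  ultimately show ?thesis
    using assms(1) by (simp add: beats_def die_Delta_def)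
qed

end
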